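(* Let $r\ge 1$, let $\mathbf a=(a_1,\dots,a_r)$ be a vector of positive integers, and let $D\ge 1$ be a common multiple of $a_1,\dots,a_r$. Then for every integer $n\ge 0$, $$\sum_{m=0}^{r-1}\sum_{v=1}^{D} d_{\mathbf a,m}(v)\,D^{n+m}\,\frac{B_{n+m+1}\left(\frac{v}{D}\right)}{n+m+1}=\frac{(-1)^{r-1}\,n!}{(n+r)!}\,B_{r+n}(\mathbf a)-\delta_{0n},$$ where $\delta_{0n}=1$ if $n=0$ and $\delta_{0n}=0$ if $n\ge 1$.
   Context: $\mathbb N=\{0,1,2,\dots\}$. The restricted partition function $p_{\mathbf a}:\mathbb N\to\mathbb N$ is $p_{\mathbf a}(n)=\#\{(x_1,\dots,x_r)\in\mathbb N^r:\sum_{i=1}^r a_ix_i=n\}$. By a theorem of Bell, $p_{\mathbf a}$ is a quasi-polynomial of degree $r-1$ with period $D$: $p_{\mathbf a}(n)=d_{\mathbf a,r-1}(n)n^{r-1}+\cdots+d_{\mathbf a,1}(n)n+d_{\mathbf a,0}(n)$ for all $n\ge 0$, where $d_{\mathbf a,m}(n+D)=d_{\mathbf a,m}(n)$ for all $0\le m\le r-1$, $n\ge 0$, and $d_{\mathbf a,r-1}$ is not identically zero; the $d_{\mathbf a,m}$ denote these coefficient functions. The Bernoulli polynomials $B_n(x)$ are defined by $\frac{ze^{xz}}{e^z-1}=\sum_{n\ge 0}B_n(x)\frac{z^n}{n!}$. The Bernoulli-Barnes numbers $B_j(\mathbf a)$ are defined by $\frac{z^r}{(e^{a_1z}-1)\cdots(e^{a_rz}-1)}=\sum_{j\ge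 0}B_j(\mathbf a)\frac{z^j}{j!}$.
   Formalization: The Kronecker delta enters with a plus sign instead of the printed minus sign: for r=1, a=(1), D=1, n=0 the left side is 1/2 while the printed right side is -3/2; for n≥1 the identity is unchanged. *)

theory Defs
  imports Complex_Main "HOL-Computational_Algebra.Formal_Power_Series"
begin

definition restricted_partitions :: "nat list \<Rightarrow> nat \<Rightarrow> nat" where
  "restricted_partitions a n =
     card {x :: nat list. length x = length a \<and> (\<Sum>i<length a. a ! i * x ! i) = n}"

text \<open>
  The coefficient functions \<open>d\<^sub>a\<^sub>,\<^sub>m\<close> are written \<open>d m\<close>, for \<open>m < length a\<close>. On each residue
  class modulo \<open>D\<close> they are the coefficients of a polynomial with prescribed values at
  infinitely many points, so the predicate determines them uniquely (values \<open>d m\<close> with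
  \<open>m \<ge> length a\<close> are irrelevant); they exist by Bell's theorem when all entries of \<open>a\<close> are
  positive and divide \<open>D > 0\<close>.
\<close>

definition quasi_polynomial_coeffs :: "nat list \<Rightarrow> nat \<Rightarrow> (nat \<Rightarrow> nat \<Rightarrow> real) \<Rightarrow> bool" where
  "quasi_polynomial_coeffs a D d \<longleftrightarrow>
     (\<forall>n. real (restricted_partitions a n) = (\<Sum>m = 0..length a - 1. d m n * real n ^ m)) \<and>
     (\<forall>m \<le> length a - 1. \<forall>n. d m (n + D) = d m n) \<and>
     (\<exists>n. d (length a - 1) n \<noteq> 0)"

text \<open>
  Division of power series truncates in general, but the two quotients below are exact; see
  \<open>bernoulli_polynomial_egf\<close> and \<open>bernoulli_barnes_egf\<close>.
\<close>

definition bernoulli_polynomial :: "nat \<Rightarrow> real \<Rightarrow> real" where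
  "bernoulli_polynomial n x = fact n * fps_nth (fps_X * fps_exp x / (fps_exp 1 - 1)) n"

definition bernoulli_barnes :: "nat list \<Rightarrow> nat \<Rightarrow> real" where
  "bernoulli_barnes a j =
     fact j * fps_nth (fps_X ^ length a / (\<Prod>c\<leftarrow>a. fps_exp (real c) - 1)) j"

lemma fps_exp_minus_one_eq:
  fixes c :: real
  shows "fps_exp c - 1 = fps_X * Abs_fps (\<lambda>n. c ^ Suc n / fact (Suc n))"
  by (rule fps_ext) (auto simp: fps_X_mult_nth power_eq_if simp del: fact_Suc)

lemma fps_exp_minus_one_dvd_X:
  fixes c :: real
  assumes "c \<noteq> 0"
  shows "fps_exp c - 1 dvd fps_X"
proof -
  have "is_unit (Abs_fps (\<lambda>n. c ^ Suc n / fact (Suc n)))"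
    using assms by simp
  then show ?thesis
    unfolding fps_exp_minus_one_eq by (simp add: mult_unit_dvd_iff)
qed

lemma bernoulli_polynomial_egf:
  "Abs_fps (\<lambda>n. bernoulli_polynomial n x / fact n) * (fps_exp 1 - 1) = fps_X * fps_exp x"
proof -
  have "fps_exp 1 - 1 dvd fps_X * fps_exp x"
    using fps_exp_minus_one_dvd_X[of 1] by simp
  then show ?thesis
    by (simp add: bernoulli_polynomial_def fps_nth_inverse)
qed

lemma bernoulli_barnes_egf:
  assumes "\<forall>c \<in> set a. c > 0"
  shows "Abs_fps (\<lambda>j. bernoulli_barnes a j / fact j) * (\<Prod>c\<leftarrow>a. fps_exp (real c) - 1)
           = fps_X ^ length a"
proof -
  have "(\<Prod>c\<leftarrow>a. fps_exp (real c) - 1) dvd fps_X ^ length a"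
    using assms
    by (induction a) (auto intro!: mult_dvd_mono fps_exp_minus_one_dvd_X)
  then show ?thesis
    by (simp add: bernoulli_barnes_def fps_nth_inverse)
qed

text \<open>
  The following values fix the sign of the Kronecker delta that arises when the Bernoulli
  polynomials are evaluated at \<open>v / D\<close> with \<open>v\<close> running over \<open>1, \<dots>, D\<close>: the point \<open>v = D\<close>
  contributes \<open>B\<^sub>1(1) = 1/2\<close>, while \<open>B\<^sub>1(0) = -1/2\<close>. For the vector \<open>(1)\<close> with \<open>D = 1\<close> and \<open>n = 0\<close>
  the sum is \<open>1/2\<close> and the Bernoulli-Barnes term is \<open>-1/2\<close>, so the delta enters with a plus
  sign, and a minus sign is refuted.
\<close>

lemma bernoulli_polynomial_1: "bernoulli_polynomial 1 x = x - 1/2"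
proof -
  let ?f = "Abs_fps (\<lambda>n. bernoulli_polynomial n x / fact n)"
  have c: "fps_nth (?f * (fps_exp 1 - 1)) k = fps_nth (fps_X * fps_exp x) k" for k
    by (simp only: bernoulli_polynomial_egf)
  show ?thesis
    using c[of 1] c[of 2]
    by (simp add: fps_mult_nth numeral_2_eq_2 algebra_simps)
qed

lemma bernoulli_barnes_single: "bernoulli_barnes [1] j = bernoulli_polynomial j 0"
  by (simp add: bernoulli_barnes_def bernoulli_polynomial_def)

lemma quasi_polynomial_coeffs_single: "quasi_polynomial_coeffs [1] 1 (\<lambda>m n. 1)"
proof -
  have "{x :: nat list. length x = Suc 0 \<and> x ! 0 = n} = {[n]}" for n
    by (auto simp: length_Suc_conv)
  then show ?thesis
    by (simp add: quasi_polynomial_coeffs_def restricted_partitions_def)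
qed

lemma minus_delta_refuted:
  "\<exists>a D d. a \<noteq> [] \<and> (\<forall>c \<in> set a. c > 0 \<and> c dvd D) \<and> D \<ge> 1 \<and>
     quasi_polynomial_coeffs a D d \<and>
     (\<Sum>m = 0..length a - 1. \<Sum>v = 1..D. d m v * real D ^ (0 + m) *
         (bernoulli_polynomial (0 + m + 1) (real v / real D) / real (0 + m + 1)))
       \<noteq> (-1) ^ (length a - 1) * fact 0 / fact (0 + length a) *
           bernoulli_barnes a (length a + 0) - 1"
  by (rule exI[of _ "[1]"], rule exI[of _ 1], rule exI[of _ "\<lambda>m n. 1"])
     (use quasi_polynomial_coeffs_single bernoulli_polynomial_1 bernoulli_barnes_single[of 1]
      in simp)

end

theory Submission
  imports Defs "HOL-Computational_Algebra.Polynomial_FPS"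
    "HOL-Computational_Algebra.Formal_Laurent_Series"
begin

text \<open>
  Substituting \<open>q = e\<^sup>z\<close> in a rational function of \<open>q\<close> gives a Laurent series in \<open>z\<close>, and turns
  the operator \<open>q d/dq\<close> into \<open>d/dz\<close>. The theorem compares the coefficients of \<open>z\<^sup>n\<close> of the two
  Laurent series obtained from
  \<open>\<Prod>\<^sub>i 1/(1 - q\<^bsup>a\<^sub>i\<^esup>) = \<Sum>\<^sub>k p\<^sub>a(k) q\<^sup>k = 1 + \<Sum>\<^sub>m \<Sum>\<^sub>v d\<^sub>m(v) (q d/dq)\<^sup>m (q\<^sup>v/(1 - q\<^sup>D))\<close>,
  where \<open>v\<close> runs over \<open>1, \<dots>, D\<close>: this system of residues reaches every \<open>k \<ge> 1\<close> but not \<open>k = 0\<close>,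
  whence the separate term \<open>p\<^sub>a(0) = 1\<close>.
\<close>

subsection \<open>Substitution of the exponential in a rational function\<close>

text \<open>The image of \<open>1 - q^c\<close> has constant coefficient 0 and is no unit among
  power series; in the field of Laurent series it can be cancelled.\<close>

definition exp_subst :: "real poly \<Rightarrow> real fls" where
  "exp_subst p = poly (map_poly fls_const p) (fps_to_fls (fps_exp 1))"

lemma exp_subst_0 [simp]: "exp_subst 0 = 0"
  by (simp add: exp_subst_def)

lemma exp_subst_pCons:
  "exp_subst (pCons c p) = fls_const c + fps_to_fls (fps_exp 1) * exp_subst p"
  by (simp add: exp_subst_def map_poly_pCons)

lemma exp_subst_1 [simp]: "exp_subst 1 = 1"
  by (simp add: one_pCons exp_subst_pCons)

lemma exp_subst_add: "exp_subst (p + q) = exp_subst p + exp_subst q"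
proof -
  have "map_poly fls_const (p + q) = map_poly fls_const p + map_poly fls_const q"
    by (rule poly_eqI) (simp add: coeff_map_poly fls_plus_const)
  then show ?thesis
    by (simp add: exp_subst_def)
qed

lemma exp_subst_smult: "exp_subst (smult c p) = fls_const c * exp_subst p"
  by (induction p) (simp_all add: exp_subst_pCons algebra_simps flip: fls_const_mult_const)

lemma exp_subst_diff: "exp_subst (p - q) = exp_subst p - exp_subst q"
  using exp_subst_add[of "p - q" q] by simp

lemma exp_subst_mult: "exp_subst (p * q) = exp_subst p * exp_subst q"
  by (induction p)
    (simp_all add: exp_subst_pCons exp_subst_add exp_subst_smult algebra_simps)

lemma exp_subst_monom: "exp_subst (monom 1 n) = fps_to_fls (fps_exp (real n))"
proof (induction n)
  case (Suc n)
  have "fps_exp (1 + real n) = fps_exp 1 * fps_exp (real n)"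
    by (rule fps_exp_add_mult)
  with Suc show ?case
    by (simp add: monom_Suc exp_subst_pCons fls_times_fps_to_fls)
qed (simp add: exp_subst_pCons monom_0)

text \<open>This is the chain rule: \<open>pCons 0 (pderiv p)\<close> is \<open>q dp/dq\<close>, and
  \<open>e^z\<close> is its own derivative.\<close>

lemma exp_subst_deriv: "exp_subst (pCons 0 (pderiv p)) = fls_deriv (exp_subst p)"
  by (induction p)
    (simp_all add: exp_subst_pCons exp_subst_add pderiv_pCons fls_deriv_fps_to_fls algebra_simps)

text \<open>The power series \<open>f\<close> in \<open>q\<close> is rational and \<open>F\<close> is its image under \<open>q = e\<^sup>z\<close>.\<close>

definition exp_transfer :: "real fps \<Rightarrow> real fls \<Rightarrow> bool" where
  "exp_transfer f F \<longleftrightarrow> (\<exists>p q. exp_subst q \<noteq> 0 \<and>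
     fps_of_poly q * f = fps_of_poly p \<and> exp_subst q * F = exp_subst p)"

lemma exp_transferI:
  assumes "exp_subst q \<noteq> 0" "fps_of_poly q * f = fps_of_poly p" "exp_subst q * F = exp_subst p"
  shows "exp_transfer f F"
  using assms unfolding exp_transfer_def by blast

lemma exp_transfer_poly: "exp_transfer (fps_of_poly p) (exp_subst p)"
  by (rule exp_transferI[of 1]) simp_all

lemma exp_transfer_add:
  assumes "exp_transfer f F" "exp_transfer g G"
  shows "exp_transfer (f + g) (F + G)"
proof -
  obtain p q where 1: "exp_subst q \<noteq> 0" "fps_of_poly q * f = fps_of_poly p"
    "exp_subst q * F = exp_subst p"
    using assms(1) unfolding exp_transfer_def by blast
  obtain p' q' where 2: "exp_subst q' \<noteq> 0" "fps_of_poly q' * g = fps_of_poly p'"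
    "exp_subst q' * G = exp_subst p'"
    using assms(2) unfolding exp_transfer_def by blast
  show ?thesis
  proof (rule exp_transferI[of "q * q'" _ "p * q' + p' * q"])
    show "fps_of_poly (q * q') * (f + g) = fps_of_poly (p * q' + p' * q)"
      by (simp add: fps_of_poly_mult fps_of_poly_add algebra_simps flip: 1 2)
    show "exp_subst (q * q') * (F + G) = exp_subst (p * q' + p' * q)"
      by (simp add: exp_subst_mult exp_subst_add algebra_simps flip: 1 2)
  qed (use 1 2 in \<open>simp add: exp_subst_mult\<close>)
qed

lemma exp_transfer_const_mult:
  assumes "exp_transfer f F"
  shows "exp_transfer (fps_const c * f) (fls_const c * F)"
proof -
  obtain p q where 1: "exp_subst q \<noteq> 0" "fps_of_poly q * f = fps_of_poly p"
    "exp_subst q * F = exp_subst p"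
    using assms unfolding exp_transfer_def by blast
  show ?thesis
    by (rule exp_transferI[of q _ "smult c p"])
      (simp_all add: 1(1) fps_of_poly_smult exp_subst_smult algebra_simps flip: 1(2,3))
qed

lemma exp_transfer_sum:
  assumes "\<And>x. x \<in> A \<Longrightarrow> exp_transfer (f x) (F x)"
  shows "exp_transfer (\<Sum>x\<in>A. f x) (\<Sum>x\<in>A. F x)"
  using assms
proof (induction A rule: infinite_finite_induct)
  case (insert x A)
  then show ?case
    by (simp add: exp_transfer_add)
qed (use exp_transfer_poly[of 0] in simp_all)

lemma exp_transfer_deriv:
  assumes "exp_transfer f F"
  shows "exp_transfer (fps_X * fps_deriv f) (fls_deriv F)"
proof -
  obtain p q where 1: "exp_subst q \<noteq> 0" "fps_of_poly q * f = fps_of_poly p"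
    "exp_subst q * F = exp_subst p"
    using assms unfolding exp_transfer_def by blast
  let ?p' = "pCons 0 (pderiv p)" and ?q' = "pCons 0 (pderiv q)"
  \<comment> \<open>The product rule for \<open>q d/dq\<close>, applied to \<open>q * f = p\<close>.
    Multiplied by \<open>q\<close>, it gives the quotient rule with denominator \<open>q * q\<close>
    used below.\<close>
  have 2: "fps_of_poly ?p' = fps_X * fps_of_poly q * fps_deriv f + fps_of_poly ?q' * f"
    by (simp add: fps_of_poly_pCons fps_of_poly_pderiv algebra_simps flip: 1)
  have 3: "exp_subst ?p' = exp_subst q * fls_deriv F + exp_subst ?q' * F"
    by (simp add: exp_subst_deriv flip: 1)
  show ?thesis
  proof (rule exp_transferI[of "q * q" _ "q * ?p' - p * ?q'"])
    have "fps_of_poly (q * ?p' - p * ?q') =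
        fps_of_poly q * fps_of_poly ?p' - fps_of_poly p * fps_of_poly ?q'"
      by (simp only: fps_of_poly_mult fps_of_poly_diff)
    also have "\<dots> = fps_of_poly (q * q) * (fps_X * fps_deriv f)"
      unfolding 2 1(2)[symmetric] by (simp add: fps_of_poly_mult algebra_simps)
    finally show "fps_of_poly (q * q) * (fps_X * fps_deriv f) = fps_of_poly (q * ?p' - p * ?q')" ..
    have "exp_subst (q * ?p' - p * ?q') =
        exp_subst q * exp_subst ?p' - exp_subst p * exp_subst ?q'"
      by (simp only: exp_subst_mult exp_subst_diff)
    also have "\<dots> = exp_subst (q * q) * fls_deriv F"
      unfolding 3 1(3)[symmetric] by (simp add: exp_subst_mult algebra_simps)
    finally show "exp_subst (q * q) * fls_deriv F = exp_subst (q * ?p' - p * ?q')" ..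
  qed (use 1 in \<open>simp add: exp_subst_mult\<close>)
qed

lemma exp_transfer_deriv_funpow:
  assumes "exp_transfer f F"
  shows "exp_transfer (((\<lambda>g. fps_X * fps_deriv g) ^^ m) f) ((fls_deriv ^^ m) F)"
  by (induction m) (simp_all add: assms exp_transfer_deriv)

text \<open>The image does not depend on the representing fraction: cross-multiplication gives an
  identity of polynomials, which survives the substitution, and the images of the denominators
  cancel. This allows one generating function to be evaluated in two ways.\<close>

lemma exp_transfer_unique:
  assumes "exp_transfer f F" "exp_transfer f G"
  shows "F = G"
proof -
  obtain p q where 1: "exp_subst q \<noteq> 0" "fps_of_poly q * f = fps_of_poly p"
    "exp_subst q * F = exp_subst p"
    using assms(1) unfolding exp_transfer_def by blast
  obtain p' q' where 2: "exp_subst q' \<noteq> 0" "fps_of_poly q' * f = fps_of_poly p'"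
    "exp_subst q' * G = exp_subst p'"
    using assms(2) unfolding exp_transfer_def by blast
  have "fps_of_poly (q' * p) = fps_of_poly (q * p')"
    by (simp add: fps_of_poly_mult algebra_simps flip: 1 2)
  then have "q' * p = q * p'"
    by (simp only: fps_of_poly_eq_iff)
  then have "exp_subst q' * (exp_subst q * F) = exp_subst q * (exp_subst q' * G)"
    by (simp add: 1 2 flip: exp_subst_mult)
  with 1(1) 2(1) show ?thesis
    by simp
qed

text \<open>Each \<open>fps_X ^ k\<close> is an eigenvector of the operator with eigenvalue
  \<open>k\<close>; this produces the powers of \<open>k\<close> in the quasi-polynomial.\<close>

lemma fps_nth_X_deriv_funpow:
  "fps_nth (((\<lambda>g. fps_X * fps_deriv g) ^^ m) f) k = real k ^ m * fps_nth f k"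
  for f :: "real fps"
  by (induction m) (auto simp: fps_X_mult_nth)

text \<open>Weighted by factorials, the coefficients at nonnegative indices are merely shifted by
  differentiation; the polar part never reaches them.\<close>

lemma fls_nth_deriv_funpow:
  "fact n * fls_nth ((fls_deriv ^^ m) F) (int n) = fact (n + m) * fls_nth F (int (n + m))"
  for F :: "real fls"
proof (induction m arbitrary: n)
  case (Suc m)
  have "fact n * fls_nth ((fls_deriv ^^ Suc m) F) (int n) =
      fact (Suc n) * fls_nth ((fls_deriv ^^ m) F) (int (Suc n))"
    by (simp add: algebra_simps)
  also have "\<dots> = fact (n + Suc m) * fls_nth F (int (n + Suc m))"
    by (subst Suc) simp
  finally show ?case .
qed simp

lemma exp_subst_one_minus_monom:
  "exp_subst (1 - monom 1 c) = 1 - fps_to_fls (fps_exp (real c))"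
  by (simp add: exp_subst_diff exp_subst_monom)

lemma exp_subst_one_minus_monom_nonzero:
  assumes "c > 0"
  shows "exp_subst (1 - monom 1 c) \<noteq> 0"
proof -
  have "fps_exp (real c) \<noteq> fps_exp 0"
    using assms by (simp only: fps_exp_eq_iff)
  then show ?thesis
    by (simp add: exp_subst_one_minus_monom)
qed

subsection \<open>Restricted partitions\<close>

lemma restricted_partitions_Nil: "restricted_partitions [] n = of_bool (n = 0)"
  by (auto simp: restricted_partitions_def)

text \<open>Positive coefficients bound every entry of a solution by \<open>n\<close>.\<close>

lemma finite_restricted_partitions:
  assumes "\<forall>c \<in> set a. c > 0"
  shows "finite {x :: nat list. length x = length a \<and> (\<Sum>i<length a. a ! i * x ! i) = n}"
proof (rule finite_subset)
  show "finite {x :: nat list. set x \<subseteq> {..n} \<and> length x = length a}"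
    by (intro finite_lists_length_eq) simp
  show "{x. length x = length a \<and> (\<Sum>i<length a. a ! i * x ! i) = n}
      \<subseteq> {x. set x \<subseteq> {..n} \<and> length x = length a}"
  proof (clarsimp simp: in_set_conv_nth)
    fix x :: "nat list" and i
    assume x: "length x = length a" "i < length a"
    have "a ! i > 0"
      using x assms by simp
    then have "x ! i \<le> a ! i * x ! i"
      by simp
    also have "\<dots> \<le> (\<Sum>i<length a. a ! i * x ! i)"
      by (rule member_le_sum) (use x in auto)
    finally show "x ! i \<le> (\<Sum>i<length a. a ! i * x ! i)" .
  qed
qed

text \<open>Solutions with first entry 0 are solutions for \<open>a\<close>; in all others the first
  entry can be lowered by one, which leaves a solution for \<open>n - c\<close>.\<close>

lemma restricted_partitions_Cons:
  assumes "\<forall>c' \<in> set (c # a). c' > 0"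
  shows "restricted_partitions (c # a) n =
    restricted_partitions a n + (if c \<le> n then restricted_partitions (c # a) (n - c) else 0)"
proof -
  define S where
    "S a n = {x :: nat list. length x = length a \<and> (\<Sum>i<length a. a ! i * x ! i) = n}" for a n
  have S_Cons: "S (c # a) n = {y # ys | y ys. length ys = length a \<and>
      c * y + (\<Sum>i<length a. a ! i * ys ! i) = n}" for n
    by (auto simp: S_def length_Suc_conv sum.lessThan_Suc_shift simp del: sum.lessThan_Suc)
  \<comment> \<open>The solutions with positive first entry. The case \<open>c > n\<close> is
    separated because truncated subtraction would turn \<open>n - c\<close> into 0.\<close>
  define T where "T = (if c \<le> n then (\<lambda>x. Suc (hd x) # tl x) ` S (c # a) (n - c) else {})"
  have "S (c # a) n = (#) 0 ` S a n \<union> T"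
  proof (intro equalityI subsetI)
    fix x
    assume "x \<in> S (c # a) n"
    then obtain y ys where x: "x = y # ys" "length ys = length a"
        "c * y + (\<Sum>i<length a. a ! i * ys ! i) = n"
      by (auto simp: S_Cons)
    show "x \<in> (#) 0 ` S a n \<union> T"
    proof (cases y)
      case 0
      with x show ?thesis by (auto simp: S_def)
    next
      case (Suc z)
      have "z # ys \<in> S (c # a) (n - c)"
        using x Suc by (auto simp: S_Cons)
      moreover have "c \<le> n"
        using x Suc by auto
      ultimately have "x \<in> T"
        unfolding T_def using Suc x by (auto intro!: image_eqI[of _ _ "z # ys"])
      then show ?thesis ..
    qed
  next
    fix x
    assume "x \<in> (#) 0 ` S a n \<union> T"
    then show "x \<in> S (c # a) n"
      by (auto simp: S_Cons T_def split: if_splits) (auto simp: S_def)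
  qed
  moreover have "finite (S a n)" "finite (S (c # a) (n - c))"
    unfolding S_def using assms by (intro finite_restricted_partitions; simp)+
  moreover have "(#) 0 ` S a n \<inter> T = {}"
    by (auto simp: T_def)
  moreover have "inj_on (\<lambda>x. Suc (hd x) # tl x) (S (c # a) (n - c))"
    by (auto simp: S_Cons inj_on_def)
  ultimately have "card (S (c # a) n) =
      card (S a n) + (if c \<le> n then card (S (c # a) (n - c)) else 0)"
    by (auto simp: card_Un_disjoint T_def card_image)
  then show ?thesis
    by (simp only: S_def restricted_partitions_def)
qed

text \<open>By the recursion, multiplication by \<open>1 - fps_X ^ c\<close> removes the entry
  \<open>c\<close> from the vector.\<close>

lemma restricted_partitions_gf:
  assumes "\<forall>c \<in> set a. c > 0"
  shows "(\<Prod>c\<leftarrow>a. 1 - fps_X ^ c) * Abs_fps (\<lambda>k. real (restricted_partitions a k)) = 1"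
  using assms
proof (induction a)
  case Nil
  show ?case
    by (rule fps_ext) (simp add: restricted_partitions_Nil)
next
  case (Cons c a)
  have "(1 - fps_X ^ c) * Abs_fps (\<lambda>k. real (restricted_partitions (c # a) k)) =
      Abs_fps (\<lambda>k. real (restricted_partitions a k))"
    by (rule fps_ext)
      (simp add: left_diff_distrib fps_X_power_mult_nth restricted_partitions_Cons[OF Cons.prems])
  with Cons show ?case
    by (simp add: mult.assoc mult.left_commute[of "1 - fps_X ^ c"])
qed

text \<open>The factors \<open>1 / (1 - e^(cz))\<close> differ from those of the Bernoulli-Barnes
  series by one sign each, and \<open>fls_shift\<close> divides by \<open>z^r\<close>, where
  \<open>r\<close> is the length of \<open>a\<close>.\<close>

lemma exp_transfer_restricted_partitions:
  assumes "\<forall>c \<in> set a. c > 0"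
  shows "exp_transfer (Abs_fps (\<lambda>k. real (restricted_partitions a k)))
    (fls_shift (int (length a))
      (fps_to_fls (Abs_fps (\<lambda>j. (-1) ^ length a * (bernoulli_barnes a j / fact j)))))"
    (is "exp_transfer _ (fls_shift _ (fps_to_fls ?B))")
proof (rule exp_transferI[of "\<Prod>c\<leftarrow>a. 1 - monom 1 c" _ 1])
  show "exp_subst (\<Prod>c\<leftarrow>a. 1 - monom 1 c) \<noteq> 0"
    using assms
    by (induction a) (auto simp: exp_subst_mult exp_subst_one_minus_monom_nonzero)
  have "fps_of_poly (\<Prod>c\<leftarrow>a. 1 - monom 1 c) = (\<Prod>c\<leftarrow>a. 1 - fps_X ^ c :: real fps)"
    by (induction a) (simp_all add: fps_of_poly_mult fps_of_poly_diff fps_of_poly_monom')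
  with restricted_partitions_gf[OF assms]
  show "fps_of_poly (\<Prod>c\<leftarrow>a. 1 - monom 1 c) * Abs_fps (\<lambda>k. real (restricted_partitions a k)) =
      fps_of_poly 1"
    by simp
  have prod: "exp_subst (\<Prod>c\<leftarrow>a. 1 - monom 1 c) =
      fps_to_fls ((-1) ^ length a * (\<Prod>c\<leftarrow>a. fps_exp (real c) - 1))"
  proof (induction a)
    case (Cons c a)
    have "1 - fps_to_fls (fps_exp (real c)) = fps_to_fls (1 - fps_exp (real c))"
      by simp
    then have "exp_subst (\<Prod>c\<leftarrow>c # a. 1 - monom 1 c) = fps_to_fls
        ((1 - fps_exp (real c)) * ((-1) ^ length a * (\<Prod>c\<leftarrow>a. fps_exp (real c) - 1)))"
      by (simp only: list.map prod_list.Cons exp_subst_mult exp_subst_one_minus_monom Cons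
          fls_times_fps_to_fls)
    then show ?case
      by (simp add: algebra_simps)
  qed simp
  have "?B = (-1) ^ length a * Abs_fps (\<lambda>j. bernoulli_barnes a j / fact j)"
    by (rule fps_ext) (cases "even (length a)"; simp)
  then have "(-1) ^ length a * (\<Prod>c\<leftarrow>a. fps_exp (real c) - 1) * ?B =
      ((-1) ^ length a * (-1) ^ length a) * fps_X ^ length a"
    by (simp only: bernoulli_barnes_egf[OF assms, symmetric] mult_ac)
  also have "\<dots> = fps_X ^ length a"
    by (simp flip: power_add mult_2)
  finally have "exp_subst (\<Prod>c\<leftarrow>a. 1 - monom 1 c) * fps_to_fls ?B = fls_X ^ length a"
    by (simp only: prod flip: fls_times_fps_to_fls) (simp add: fps_to_fls_power)
  then show "exp_subst (\<Prod>c\<leftarrow>a. 1 - monom 1 c) * fls_shift (int (length a)) (fps_to_fls ?B) =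
      exp_subst 1"
    by (simp add: fls_shifted_times_simps fls_X_power_conv_shift_1)
qed

subsection \<open>Arithmetic progressions\<close>

text \<open>The generating function at \<open>v / D\<close> with \<open>D z\<close> substituted for
  \<open>z\<close>.\<close>

lemma bernoulli_polynomial_egf_scaled:
  assumes "D > 0"
  shows "Abs_fps (\<lambda>j. D ^ j * (bernoulli_polynomial j (v / D) / fact j)) * (fps_exp D - 1) =
    fps_const D * fps_X * fps_exp v"
proof -
  let ?L = "fps_const D * fps_X"
  have "Abs_fps (\<lambda>j. bernoulli_polynomial j (v / D) / fact j) * (fps_exp 1 - 1) oo ?L =
      fps_X * fps_exp (v / D) oo ?L"
    by (simp only: bernoulli_polynomial_egf)
  moreover have "fps_nth ?L 0 = 0"
    by simp
  ultimately have "Abs_fps (\<lambda>j. bernoulli_polynomial j (v / D) / fact j) oo ?L =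
      Abs_fps (\<lambda>j. D ^ j * (bernoulli_polynomial j (v / D) / fact j)) \<Longrightarrow> ?thesis"
    using assms by (simp add: fps_compose_mult_distrib fps_compose_sub_distrib)
  then show ?thesis
    by (simp add: fps_compose_linear)
qed

text \<open>The indicator series is \<open>q^v / (1 - q^D)\<close>, with image
  \<open>e^(vz) / (1 - e^(Dz))\<close>. This is the scaled Bernoulli series divided by
  \<open>- D z\<close>; \<open>fls_shift 1\<close> accounts for the simple pole.\<close>

lemma exp_transfer_progression:
  assumes "D > 0"
  shows "exp_transfer (Abs_fps (\<lambda>k. of_bool (v \<le> k \<and> D dvd k - v)))
    (fls_shift 1 (fps_to_fls (Abs_fps (\<lambda>j.
      - (real D ^ j * (bernoulli_polynomial j (real v / real D) / fact j) / real D)))))"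
    (is "exp_transfer ?f (fls_shift 1 (fps_to_fls ?B))")
proof (rule exp_transferI[of "1 - monom 1 D" _ "monom 1 v"])
  show "exp_subst (1 - monom 1 D) \<noteq> 0"
    using assms by (rule exp_subst_one_minus_monom_nonzero)
  \<comment> \<open>Coefficient \<open>k\<close> of \<open>(1 - fps_X ^ D) * ?f\<close>: each term
    of the progression cancels against its predecessor, so only the first one, \<open>k = v\<close>,
    remains.\<close>
  have *: "of_bool (v \<le> k \<and> D dvd k - v) - (if k < D then 0 else of_bool (v \<le> k - D \<and> D dvd k - D - v))
      = (of_bool (k = v) :: real)" for k
  proof (cases "D + v \<le> k")
    case True
    then have "k - v = D + (k - D - v)"
      by simp
    then have "D dvd k - v \<longleftrightarrow> D dvd k - D - v"
      by (simp only: dvd_add_triv_left_iff)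
    with True assms show ?thesis
      by auto
  next
    case False
    then have "v \<le> k \<and> D dvd k - v \<longleftrightarrow> k = v"
      using nat_dvd_not_less[of "k - v" D] by fastforce
    with False show ?thesis
      by auto
  qed
  have "(1 - fps_X ^ D) * ?f = fps_X ^ v"
    by (rule fps_ext)
      (simp only: left_diff_distrib fps_sub_nth fps_X_power_mult_nth fps_X_power_nth mult_1
        fps_nth_Abs_fps *[unfolded of_bool_def] of_bool_def)
  then show "fps_of_poly (1 - monom 1 D) * ?f = fps_of_poly (monom 1 v)"
    by (simp only: fps_of_poly_diff fps_of_poly_monom' fps_of_poly_1)
  have "(1 - fps_exp (real D)) * ?B = fps_const (1 / real D) *
      (Abs_fps (\<lambda>j. real D ^ j * (bernoulli_polynomial j (real v / real D) / fact j)) *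
        (fps_exp (real D) - 1))"
  proof -
    have "?B = - (fps_const (1 / real D) *
        Abs_fps (\<lambda>j. real D ^ j * (bernoulli_polynomial j (real v / real D) / fact j)))"
      by (rule fps_ext) simp
    then show ?thesis
      by (simp only:) (simp add: algebra_simps)
  qed
  also have "\<dots> = fps_const (1 / real D) * (fps_const (real D) * fps_X * fps_exp (real v))"
    using assms by (subst bernoulli_polynomial_egf_scaled) simp_all
  also have "\<dots> = fps_X * fps_exp (real v)"
    using assms by (simp flip: mult.assoc)
  finally have "exp_subst (1 - monom 1 D) * fps_to_fls ?B = fls_X * fps_to_fls (fps_exp (real v))"
    by (simp only: exp_subst_one_minus_monom
        flip: fls_times_fps_to_fls fps_X_to_fls fps_to_fls_minus fps_one_to_fls)
  then show "exp_subst (1 - monom 1 D) * fls_shift 1 (fps_to_fls ?B) = exp_subst (monom 1 v)"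
    by (simp add: fls_shifted_times_simps fls_X_times_conv_shift exp_subst_monom)
qed

section \<open>Decomposition of the generating function into residue classes\<close>

lemma sum_progressions:
  fixes D k :: nat
  assumes "D > 0"
  shows "(\<Sum>v = 1..D. of_bool (v \<le> k \<and> D dvd k - v)) = (of_bool (k \<noteq> 0) :: real)"
proof (cases "k = 0")
  case False
  \<comment> \<open>The representative of \<open>k\<close> modulo \<open>D\<close> in
    \<open>{1..D}\<close>; the shift by one makes \<open>D\<close>, not 0, stand for the multiples
    of \<open>D\<close>. As \<open>k > 0\<close>, it does not exceed \<open>k\<close>.\<close>
  have "{1..D} \<inter> {v. v \<le> k \<and> D dvd k - v} = {(k - 1) mod D + 1}"
  proof (intro equalityI subsetI)
    fix v
    assume "v \<in> {1..D} \<inter> {v. v \<le> k \<and> D dvd k - v}"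
    then have v: "1 \<le> v" "v \<le> D" "v \<le> k" "D dvd k - v"
      by auto
    then obtain j where "k = v + D * j"
      by (metis dvdE le_add_diff_inverse)
    with v have "k - 1 = v - 1 + D * j"
      by simp
    then have "(k - 1) mod D = (v - 1) mod D"
      by (simp only: mod_mult_self2)
    also have "\<dots> = v - 1"
      using v by simp
    finally show "v \<in> {(k - 1) mod D + 1}"
      using v by simp
  next
    fix v
    assume "v \<in> {(k - 1) mod D + 1}"
    then have v: "v = (k - 1) mod D + 1"
      by simp
    have "(k - 1) mod D \<le> k - 1" "(k - 1) mod D < D"
      using assms by simp_all
    with v False have "v \<in> {1..D}" "v \<le> k"
      by (auto simp del: mod_less_eq_dividend)
    moreover have "k - v = (k - 1) - (k - 1) mod D"
      using v by simp
    then have "D dvd k - v"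
      by (simp only: dvd_minus_mod)
    ultimately show "v \<in> {1..D} \<inter> {v. v \<le> k \<and> D dvd k - v}"
      by simp
  qed
  then show ?thesis
    using False by (simp only: sum_of_bool_eq finite_atLeastAtMost) simp
qed (auto intro!: sum.neutral)

text \<open>By periodicity \<open>d m\<close> is constant on each progression, so coefficient
  \<open>k\<close> of the double sum is the quasi-polynomial at \<open>k\<close> if
  \<open>k > 0\<close>, and 0 if \<open>k = 0\<close>.\<close>

lemma quasi_polynomial_gf:
  assumes "\<forall>c \<in> set a. c > 0" "D > 0" "quasi_polynomial_coeffs a D d"
  shows "Abs_fps (\<lambda>k. real (restricted_partitions a k)) =
    1 + (\<Sum>m = 0..length a - 1. \<Sum>v = 1..D. fps_const (d m v) *
      (((\<lambda>g. fps_X * fps_deriv g) ^^ m) (Abs_fps (\<lambda>k. of_bool (v \<le> k \<and> D dvd k - v)))))"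
proof (rule fps_ext)
  fix k
  have p: "real (restricted_partitions a k) = (\<Sum>m = 0..length a - 1. d m k * real k ^ m)"
    using assms(3) by (simp add: quasi_polynomial_coeffs_def)
  have per: "d m k = d m v" if "m \<le> length a - 1" "v \<le> k" "D dvd k - v" for m v
  proof -
    have "d m (v + D * j) = d m v" for j
    proof (induction j)
      case (Suc j)
      have "d m (v + D * Suc j) = d m ((v + D * j) + D)"
        by (simp add: algebra_simps)
      with Suc that(1) assms(3) show ?case
        by (simp only: quasi_polynomial_coeffs_def)
    qed simp
    then show ?thesis
      using that(2,3) by (metis dvdE le_add_diff_inverse)
  qed
  have "(\<Sum>m = 0..length a - 1. \<Sum>v = 1..D.
          d m v * (real k ^ m * of_bool (v \<le> k \<and> D dvd k - v))) =
      (\<Sum>m = 0..length a - 1. \<Sum>v = 1..D.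
          d m k * real k ^ m * of_bool (v \<le> k \<and> D dvd k - v))"
    by (intro sum.cong refl) (auto simp: per)
  also have "\<dots> = of_bool (k \<noteq> 0) * real (restricted_partitions a k)"
    by (simp only: sum_progressions[OF assms(2)] p mult.commute
        flip: sum_distrib_left sum_distrib_right)
  finally have *: "(\<Sum>m = 0..length a - 1. \<Sum>v = 1..D.
      d m v * (real k ^ m * of_bool (v \<le> k \<and> D dvd k - v))) =
      of_bool (k \<noteq> 0) * real (restricted_partitions a k)" .
  \<comment> \<open>At \<open>k = 0\<close> the double sum vanishes and the separate summand 1
    supplies the whole coefficient.\<close>
  have "restricted_partitions a 0 = 1"
    using assms(1)
    by (induction a) (simp_all add: restricted_partitions_Nil restricted_partitions_Cons)
  then show "fps_nth (Abs_fps (\<lambda>k. real (restricted_partitions a k))) k =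
    fps_nth (1 + (\<Sum>m = 0..length a - 1. \<Sum>v = 1..D. fps_const (d m v) *
      (((\<lambda>g. fps_X * fps_deriv g) ^^ m) (Abs_fps (\<lambda>k. of_bool (v \<le> k \<and> D dvd k - v)))))) k"
    using * by (simp add: fps_sum_nth fps_nth_X_deriv_funpow)
qed

section \<open>Comparison of the Laurent coefficients\<close>

theorem mainTheorem1:
  fixes a :: "nat list" and r D n :: nat and d :: "nat \<Rightarrow> nat \<Rightarrow> real"
  assumes "r \<ge> 1"
    and "length a = r"
    and "\<forall>i<r. a ! i > 0"
    and "D \<ge> 1"
    and "\<forall>i<r. a ! i dvd D"
    and "quasi_polynomial_coeffs a D d"
  shows "(\<Sum>m = 0..r - 1. \<Sum>v = 1..D.
            d m v * real D ^ (n + m) *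
              (bernoulli_polynomial (n + m + 1) (real v / real D) / real (n + m + 1)))
         = (-1) ^ (r - 1) * fact n / fact (n + r) * bernoulli_barnes a (r + n)
             + (if n = 0 then 1 else 0)"
proof -
  have pos: "\<forall>c \<in> set a. c > 0" and D: "D > 0"
    using assms by (auto simp: in_set_conv_nth)
  define P where "P v = fls_shift 1 (fps_to_fls (Abs_fps (\<lambda>j.
      - (real D ^ j * (bernoulli_polynomial j (real v / real D) / fact j) / real D))))" for v
  define H where "H = fls_shift (int r)
      (fps_to_fls (Abs_fps (\<lambda>j. (-1) ^ r * (bernoulli_barnes a j / fact j))))"
  have "exp_transfer (Abs_fps (\<lambda>k. real (restricted_partitions a k)))
      (1 + (\<Sum>m = 0..r - 1. \<Sum>v = 1..D. fls_const (d m v) * (fls_deriv ^^ m) (P v)))"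
    unfolding quasi_polynomial_gf[OF pos D assms(6)] P_def assms(2)
    using exp_transfer_poly[of 1]
    by (intro exp_transfer_add exp_transfer_sum exp_transfer_const_mult
        exp_transfer_deriv_funpow exp_transfer_progression D) simp
  moreover have "exp_transfer (Abs_fps (\<lambda>k. real (restricted_partitions a k))) H"
    using exp_transfer_restricted_partitions[OF pos] by (simp add: H_def assms(2))
  ultimately have
    "H = 1 + (\<Sum>m = 0..r - 1. \<Sum>v = 1..D. fls_const (d m v) * (fls_deriv ^^ m) (P v))"
    by (rule exp_transfer_unique[rotated])
  \<comment> \<open>The constant series 1, which stems from the value of the partition function at
    0, yields the Kronecker term. It keeps its plus sign, in agreement with
    \<open>minus_delta_refuted\<close>.\<close>
  then have "fact n * fls_nth H (int n) = (if n = 0 then 1 else 0) +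
      (\<Sum>m = 0..r - 1. \<Sum>v = 1..D. d m v * (fact n * fls_nth ((fls_deriv ^^ m) (P v)) (int n)))"
    by (simp add: fls_nth_sum sum_distrib_left algebra_simps)
  \<comment> \<open>The pole moves the index to \<open>n + m + 1\<close>:
    \<open>fact (n + m)\<close> over \<open>fact (n + m + 1)\<close> leaves the denominator
    \<open>n + m + 1\<close>, and the extra factor \<open>D\<close> cancels.\<close>
  moreover have "fact n * fls_nth ((fls_deriv ^^ m) (P v)) (int n) = - (real D ^ (n + m) *
      (bernoulli_polynomial (n + m + 1) (real v / real D) / real (n + m + 1)))" for m v
  proof -
    have "nat (int (n + m) + 1) = Suc (n + m)"
      by simp
    then have "fls_nth (P v) (int (n + m)) = - (real D ^ Suc (n + m) *
        (bernoulli_polynomial (Suc (n + m)) (real v / real D) / fact (Suc (n + m))) / real D)"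
      by (simp add: P_def del: fact_Suc)
    then show ?thesis
      unfolding fls_nth_deriv_funpow using D by (simp add: divide_simps) (simp add: mult_ac)
  qed
  moreover have "fls_nth H (int n) = (-1) ^ r * (bernoulli_barnes a (r + n) / fact (n + r))"
  proof -
    have "nat (int n + int r) = n + r"
      by simp
    then show ?thesis
      by (simp add: H_def add.commute)
  qed
  ultimately have "fact n * ((-1) ^ r * (bernoulli_barnes a (r + n) / fact (n + r))) =
      (if n = 0 then 1 else 0) - (\<Sum>m = 0..r - 1. \<Sum>v = 1..D. d m v * real D ^ (n + m) *
        (bernoulli_polynomial (n + m + 1) (real v / real D) / real (n + m + 1)))"
    by (simp add: sum_negf mult.assoc)
  \<comment> \<open>The sign from the progressions is absorbed here; \<open>r \<ge> 1\<close> makes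
    \<open>r - 1\<close> a genuine predecessor.\<close>
  moreover have "(-1) ^ r = - ((-1) ^ (r - 1) :: real)"
    using assms(1) by (cases r) simp_all
  ultimately show ?thesis
    by (simp add: algebra_simps)
qed

end
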